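(* Let $G$ be a finite group such that $|Z(G)| = z \ge 2$ and $G/Z(G) \cong \mathbb{Z}_p \times \mathbb{Z}_p$, where $p$ is a prime, and let $\Gamma_G$ be the commuting conjugacy class graph of $G$. If $p=2$ and $z=3$, or $p\ge 3$ and $z=2$, then $$E_{CN}(\Gamma_G) < LE_{CN}(\Gamma_G) = LE^+_{CN}(\Gamma_G).$$ In all other cases, $$E_{CN}(\Gamma_G) = LE_{CN}(\Gamma_G) = LE^+_{CN}(\Gamma_G).$$
   Context: For a finite non-abelian group $G$ with center $Z(G)$, the commuting conjugacy class graph (CCC-graph) $\Gamma_G$ is the simple undirected graph whose vertices are the conjugacy classes $x^G$ of non-central elements $x \in G \setminus Z(G)$; two distinct vertices $x^G, y^G$ are adjacent if there exist $x' \in x^G$ and $y' \in y^G$ with $x'y' = y'x'$. For a finite simple graph $\mathcal{G}$ with vertices $v_1,\dots,v_N$, let $CN(\mathcal{G})$ be the $N\times N$ matrix whose $(i,j)$ entry is, for $i\ne j$, the number of vertices other than $v_i,v_j$ adjacent to both $v_i$ and $v_j$, and whose diagonal entries are $0$. $E_{CN}(\mathcal{G})$ is the sum of the absolute values of the eigenvalues of $CN(\mathcal{G})$ (with multiplicity). Let $CNRS(\mathcal{G})$ be the diagonal matrix whose $i$-th diagonal entry is the $i$-th row sum of $CN(\mathcal{G})$. Put $CNL(\mathcal{G}) = CNRS(\mathcal{G}) - CN(\mathcal{G})$, $CNSL(\mathcal{G}) = CNRS(\mathcal{G}) + CN(\mathcal{G})$ and $\Delta(\mathcal{G}) = \operatorname{tr}(CNRS(\mathcal{G}))/N$.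 Then $LE_{CN}(\mathcal{G}) = \sum_{\alpha} |\alpha - \Delta(\mathcal{G})|$ over all eigenvalues $\alpha$ of $CNL(\mathcal{G})$ with multiplicity, and $LE^+_{CN}(\mathcal{G}) = \sum_{\beta} |\beta - \Delta(\mathcal{G})|$ over all eigenvalues $\beta$ of $CNSL(\mathcal{G})$ with multiplicity. *)

theory Defs
  imports
    "HOL-Algebra.Group_Action"
    "HOL-Algebra.Elementary_Groups"
    "HOL-Computational_Algebra.Primes"
    "Jordan_Normal_Form.Char_Poly"
    "Graph_Theory.Pair_Digraph"
begin

definition center :: "('a, 'b) monoid_scheme \<Rightarrow> 'a set" where
  "center G = {z \<in> carrier G. \<forall>g \<in> carrier G. z \<otimes>\<^bsub>G\<^esub> g = g \<otimes>\<^bsub>G\<^esub> z}"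

text \<open>The orbit of \<open>x\<close> under the conjugation action of theory \<^theory>\<open>HOL-Algebra.Group_Action\<close>
  (see \<open>group.action_by_conjugation\<close>).\<close>

definition conj_class :: "('a, 'b) monoid_scheme \<Rightarrow> 'a \<Rightarrow> 'a set" where
  "conj_class G x =
     orbit G (\<lambda>g. \<lambda>h \<in> carrier G. g \<otimes>\<^bsub>G\<^esub> h \<otimes>\<^bsub>G\<^esub> inv\<^bsub>G\<^esub> g) x"

text \<open>A finite simple graph is a \<^locale>\<open>pair_graph\<close>: each edge is represented by both of its
  orientations.\<close>

definition ccc_graph :: "('a, 'b) monoid_scheme \<Rightarrow> 'a set pair_pre_digraph" where
  "ccc_graph G =
     (let V = conj_class G ` (carrier G - center G)
      in \<lparr> pverts = V,
           parcs = {(X, Y). X \<in> V \<and> Y \<in> V \<and> X \<noteq> Y \<and>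
                      (\<exists>x \<in> X. \<exists>y \<in> Y. x \<otimes>\<^bsub>G\<^esub> y = y \<otimes>\<^bsub>G\<^esub> x)} \<rparr>)"

lemma pair_graph_ccc_graph:
  assumes "finite (carrier G)"
  shows "pair_graph (ccc_graph G)"
proof -
  let ?V = "conj_class G ` (carrier G - center G)"
  have V: "pverts (ccc_graph G) = ?V" and fin: "finite ?V"
    using assms by (simp_all add: ccc_graph_def Let_def)
  have "parcs (ccc_graph G) \<subseteq> ?V \<times> ?V"
    by (auto simp: ccc_graph_def Let_def)
  then have "finite (parcs (ccc_graph G))"
    by (rule finite_subset) (use fin in blast)
  moreover have "symmetric (with_proj (ccc_graph G))"
    unfolding symmetric_def with_proj_simps
    by (rule symI) (auto simp: ccc_graph_def Let_def, metis+)
  ultimately show ?thesis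
    using V fin by unfold_locales (auto simp: ccc_graph_def Let_def)
qed

text \<open>Matrices of a graph depend on an enumeration \<open>vs\<close> of its vertices.\<close>

definition CN :: "'v pair_pre_digraph \<Rightarrow> 'v list \<Rightarrow> real mat" where
  "CN \<Gamma> vs = mat (length vs) (length vs) (\<lambda>(i, j).
     if i = j then 0
     else real (card {w \<in> pverts \<Gamma>. w \<noteq> vs ! i \<and> w \<noteq> vs ! j \<and>
                       (w, vs ! i) \<in> parcs \<Gamma> \<and> (w, vs ! j) \<in> parcs \<Gamma>}))"

definition CNRS :: "'v pair_pre_digraph \<Rightarrow> 'v list \<Rightarrow> real mat" where
  "CNRS \<Gamma> vs = mat_diag (length vs) (\<lambda>i. \<Sum>j < length vs. CN \<Gamma> vs $$ (i, j))"

definition CNL :: "'v pair_pre_digraph \<Rightarrow> 'v list \<Rightarrow> real mat" where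
  "CNL \<Gamma> vs = CNRS \<Gamma> vs - CN \<Gamma> vs"

definition CNSL :: "'v pair_pre_digraph \<Rightarrow> 'v list \<Rightarrow> real mat" where
  "CNSL \<Gamma> vs = CNRS \<Gamma> vs + CN \<Gamma> vs"

definition CN_mean :: "'v pair_pre_digraph \<Rightarrow> 'v list \<Rightarrow> real" where
  "CN_mean \<Gamma> vs = sum_list (diag_mat (CNRS \<Gamma> vs)) / real (length vs)"

text \<open>All eigenvalues over the complex numbers with algebraic multiplicity, so that none can be
  missing from the sums below.\<close>

definition eigenvalues_mset :: "real mat \<Rightarrow> complex multiset" where
  "eigenvalues_mset A = proots (char_poly (map_mat complex_of_real A))"

definition vertex_list :: "'v pair_pre_digraph \<Rightarrow> 'v list" where
  "vertex_list \<Gamma> = (SOME vs. distinct vs \<and> set vs = pverts \<Gamma>)"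

definition E_CN :: "'v pair_pre_digraph \<Rightarrow> real" where
  "E_CN \<Gamma> = (\<Sum>a \<in># eigenvalues_mset (CN \<Gamma> (vertex_list \<Gamma>)). cmod a)"

definition LE_CN :: "'v pair_pre_digraph \<Rightarrow> real" where
  "LE_CN \<Gamma> = (\<Sum>a \<in># eigenvalues_mset (CNL \<Gamma> (vertex_list \<Gamma>)).
     cmod (a - complex_of_real (CN_mean \<Gamma> (vertex_list \<Gamma>))))"

definition LE_plus_CN :: "'v pair_pre_digraph \<Rightarrow> real" where
  "LE_plus_CN \<Gamma> = (\<Sum>b \<in># eigenvalues_mset (CNSL \<Gamma> (vertex_list \<Gamma>)).
     cmod (b - complex_of_real (CN_mean \<Gamma> (vertex_list \<Gamma>))))"

text \<open>The three energies do not depend on the enumeration chosen in \<^const>\<open>vertex_list\<close>.\<close>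

lemma distinct_vertex_list:
  assumes "finite (pverts \<Gamma>)"
  shows "distinct (vertex_list \<Gamma>)" "set (vertex_list \<Gamma>) = pverts \<Gamma>"
proof -
  have "\<exists>vs. distinct vs \<and> set vs = pverts \<Gamma>"
    using finite_distinct_list[OF assms] by blast
  then have "distinct (vertex_list \<Gamma>) \<and> set (vertex_list \<Gamma>) = pverts \<Gamma>"
    unfolding vertex_list_def by (rule someI_ex)
  then show "distinct (vertex_list \<Gamma>)" "set (vertex_list \<Gamma>) = pverts \<Gamma>"
    by auto
qed

lemma sum_nth_distinct:
  assumes "distinct vs"
  shows "(\<Sum>k < length vs. g (vs ! k)) = (\<Sum>v \<in> set vs. g v)"
  by (rule sum.reindex_bij_betw[OF bij_betw_nth[OF assms]]) auto

lemma char_poly_reorder: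
  fixes f :: "'v \<Rightarrow> 'v \<Rightarrow> 'c :: comm_ring_1"
  assumes vs: "distinct vs" and ws: "distinct ws" and eq: "set vs = set ws"
  shows "char_poly (mat (length vs) (length vs) (\<lambda>(i, j). f (vs ! i) (vs ! j))) =
         char_poly (mat (length ws) (length ws) (\<lambda>(i, j). f (ws ! i) (ws ! j)))"
proof -
  define n where "n = length vs"
  have n: "length vs = n" "length ws = n"
    using distinct_card[OF vs] distinct_card[OF ws] eq by (simp_all add: n_def)
  define A where "A = mat n n (\<lambda>(i, j). f (vs ! i) (vs ! j))"
  define B where "B = mat n n (\<lambda>(i, j). f (ws ! i) (ws ! j))"
  define M where
    "M = (\<lambda>us us'. mat n n (\<lambda>(i, j). if us ! i = (us' ! j :: 'v) then 1 else (0 :: 'c)))"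
  have pick: "(\<Sum>k < n. if u = us ! k then g (us ! k) else 0) = g u"
    and pick': "(\<Sum>k < n. if us ! k = u then g (us ! k) else 0) = g u"
    if "distinct us" "length us = n" "u \<in> set us" for u us and g :: "'v \<Rightarrow> 'c"
    using that sum_nth_distinct[OF that(1), of "\<lambda>v. if u = v then g v else 0"]
      sum_nth_distinct[OF that(1), of "\<lambda>v. if v = u then g v else 0"]
    by simp_all
  have one: "M us us' * M us' us = 1\<^sub>m n"
    if "distinct us" "distinct us'" "length us = n" "length us' = n" "set us = set us'" for us us'
  proof (rule eq_matI)
    fix i j assume "i < dim_row (1\<^sub>m n :: 'c mat)" "j < dim_col (1\<^sub>m n :: 'c mat)"
    then have ij: "i < n" "j < n" by auto
    have "(M us us' * M us' us) $$ (i, j) =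
        (\<Sum>k < n. (if us ! i = us' ! k then 1 else 0) * (if us' ! k = us ! j then 1 else 0))"
      using ij by (simp add: M_def scalar_prod_def atLeast0LessThan)
    also have "\<dots> = (\<Sum>k < n. if us ! i = us' ! k then (if us' ! k = us ! j then 1 else 0) else 0)"
      by (intro sum.cong) auto
    also have "\<dots> = (if us ! i = us ! j then 1 else 0)"
      using that ij nth_mem[of i us]
      by (intro pick[where g = "\<lambda>v. if v = us ! j then 1 else 0"]) auto
    also have "\<dots> = 1\<^sub>m n $$ (i, j)"
      using ij that by (simp add: nth_eq_iff_index_eq)
    finally show "(M us us' * M us' us) $$ (i, j) = 1\<^sub>m n $$ (i, j)" .
  qed (auto simp: M_def)
  have "A = M vs ws * B * M ws vs"
  proof (rule eq_matI)
    fix i j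
    assume "i < dim_row (M vs ws * B * M ws vs)" "j < dim_col (M vs ws * B * M ws vs)"
    then have ij: "i < n" "j < n" by (auto simp: M_def)
    have mem: "vs ! i \<in> set ws" "vs ! j \<in> set ws"
      using ij n eq nth_mem by metis+
    have MB: "(M vs ws * B) $$ (i, l) = f (vs ! i) (ws ! l)" if "l < n" for l
    proof -
      have "(M vs ws * B) $$ (i, l) =
          (\<Sum>k < n. (if vs ! i = ws ! k then 1 else 0) * f (ws ! k) (ws ! l))"
        using ij that by (simp add: M_def B_def scalar_prod_def atLeast0LessThan)
      also have "\<dots> = (\<Sum>k < n. if vs ! i = ws ! k then f (ws ! k) (ws ! l) else 0)"
        by (intro sum.cong) auto
      also have "\<dots> = f (vs ! i) (ws ! l)"
        using ws n mem by (intro pick[where g = "\<lambda>v. f v (ws ! l)"]) auto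
      finally show ?thesis .
    qed
    have "(M vs ws * B * M ws vs) $$ (i, j) =
        (\<Sum>l < n. (M vs ws * B) $$ (i, l) * M ws vs $$ (l, j))"
      using ij by (simp add: M_def B_def scalar_prod_def atLeast0LessThan)
    also have "\<dots> = (\<Sum>l < n. if ws ! l = vs ! j then f (vs ! i) (ws ! l) else 0)"
      using ij by (intro sum.cong) (auto simp: MB, auto simp: M_def)
    also have "\<dots> = f (vs ! i) (vs ! j)"
      using ws n mem by (intro pick'[where g = "\<lambda>v. f (vs ! i) v"]) auto
    finally show "A $$ (i, j) = (M vs ws * B * M ws vs) $$ (i, j)"
      using ij by (simp add: A_def)
  qed (auto simp: A_def M_def)
  moreover have "{A, B, M vs ws, M ws vs} \<subseteq> carrier_mat n n"
    by (auto simp: A_def B_def M_def)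
  ultimately have "similar_mat A B"
    using one[of vs ws] one[of ws vs] vs ws n eq by (intro similar_matI) auto
  from char_poly_similar[OF this] show ?thesis
    by (simp add: A_def B_def n)
qed

lemma enumeration_independent:
  assumes vs: "distinct vs" "set vs = pverts \<Gamma>" and ws: "distinct ws" "set ws = pverts \<Gamma>"
  shows "eigenvalues_mset (CN \<Gamma> vs) = eigenvalues_mset (CN \<Gamma> ws)"
    and "eigenvalues_mset (CNL \<Gamma> vs) = eigenvalues_mset (CNL \<Gamma> ws)"
    and "eigenvalues_mset (CNSL \<Gamma> vs) = eigenvalues_mset (CNSL \<Gamma> ws)"
    and "CN_mean \<Gamma> vs = CN_mean \<Gamma> ws"
proof -
  define c :: "'a \<Rightarrow> 'a \<Rightarrow> real" where
    "c u v = (if u = v then 0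
       else real (card {w \<in> pverts \<Gamma>. w \<noteq> u \<and> w \<noteq> v \<and> (w, u) \<in> parcs \<Gamma> \<and> (w, v) \<in> parcs \<Gamma>}))" for u v
  define r where "r u = (\<Sum>v \<in> pverts \<Gamma>. c u v)" for u
  have entry: "CN \<Gamma> us $$ (i, j) = c (us ! i) (us ! j)"
    if "distinct us" "i < length us" "j < length us" for us i j
    using that by (simp add: CN_def c_def nth_eq_iff_index_eq)
  have row: "CNRS \<Gamma> us $$ (i, j) = (if i = j then r (us ! i) else 0)"
    if "distinct us" "set us = pverts \<Gamma>" "i < length us" "j < length us" for us i j
    using that sum_nth_distinct[OF that(1), of "c (us ! i)"]
    by (auto simp: CNRS_def mat_diag_def r_def entry)
  have CN: "map_mat complex_of_real (CN \<Gamma> us) =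
      mat (length us) (length us) (\<lambda>(i, j). complex_of_real (c (us ! i) (us ! j)))"
    if "distinct us" "set us = pverts \<Gamma>" for us
    by (rule eq_matI) (use that entry in \<open>auto simp: CN_def\<close>)
  have CNL: "map_mat complex_of_real (CNL \<Gamma> us) = mat (length us) (length us)
      (\<lambda>(i, j). (\<lambda>u v. complex_of_real ((if u = v then r u else 0) - c u v)) (us ! i) (us ! j))"
    if us: "distinct us" "set us = pverts \<Gamma>" for us
  proof (rule eq_matI, goal_cases)
    case (1 i j)
    then have "i < length us" "j < length us" by auto
    then show ?case
      using entry[OF us(1), of i j] row[OF us, of i j] us(1)
      by (simp add: CNL_def CN_def CNRS_def mat_diag_def nth_eq_iff_index_eq)
  qed (simp_all add: CNL_def CN_def)
  have CNSL: "map_mat complex_of_real (CNSL \<Gamma> us) = mat (length us) (length us)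
      (\<lambda>(i, j). (\<lambda>u v. complex_of_real ((if u = v then r u else 0) + c u v)) (us ! i) (us ! j))"
    if us: "distinct us" "set us = pverts \<Gamma>" for us
  proof (rule eq_matI, goal_cases)
    case (1 i j)
    then have "i < length us" "j < length us" by auto
    then show ?case
      using entry[OF us(1), of i j] row[OF us, of i j] us(1)
      by (simp add: CNSL_def CN_def CNRS_def mat_diag_def nth_eq_iff_index_eq)
  qed (simp_all add: CNSL_def CN_def)
  have mean: "CN_mean \<Gamma> us = (\<Sum>v \<in> pverts \<Gamma>. r v) / real (card (pverts \<Gamma>))"
    if us: "distinct us" "set us = pverts \<Gamma>" for us
  proof -
    have "sum_list (diag_mat (CNRS \<Gamma> us)) = (\<Sum>i < length us. CNRS \<Gamma> us $$ (i, i))"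
      by (simp add: diag_mat_def CNRS_def mat_diag_def interv_sum_list_conv_sum_set_nat
          atLeast0LessThan)
    also have "\<dots> = (\<Sum>i < length us. r (us ! i))"
      using row[OF us] by (intro sum.cong) auto
    also have "\<dots> = (\<Sum>v \<in> pverts \<Gamma>. r v)"
      using sum_nth_distinct[OF us(1), of r] us(2) by simp
    finally show ?thesis
      using distinct_card[OF us(1)] us(2) by (simp add: CN_mean_def)
  qed
  have eq: "set vs = set ws" using vs ws by simp
  note reorder = char_poly_reorder[OF vs(1) ws(1) eq]
  show "eigenvalues_mset (CN \<Gamma> vs) = eigenvalues_mset (CN \<Gamma> ws)"
    unfolding eigenvalues_mset_def CN[OF vs] CN[OF ws]
    using reorder[of "\<lambda>u v. complex_of_real (c u v)"] by simp
  show "eigenvalues_mset (CNL \<Gamma> vs) = eigenvalues_mset (CNL \<Gamma> ws)"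
    unfolding eigenvalues_mset_def CNL[OF vs] CNL[OF ws] by (rule arg_cong[OF reorder])
  show "eigenvalues_mset (CNSL \<Gamma> vs) = eigenvalues_mset (CNSL \<Gamma> ws)"
    unfolding eigenvalues_mset_def CNSL[OF vs] CNSL[OF ws] by (rule arg_cong[OF reorder])
  show "CN_mean \<Gamma> vs = CN_mean \<Gamma> ws"
    using mean[OF vs] mean[OF ws] by simp
qed

end

theory Submission
  imports Defs "Jordan_Normal_Form.Schur_Decomposition"
begin

text \<open>Every noncentral \<open>x\<close> has an abelian centralizer \<open>C(x)\<close> of order \<open>pz\<close>, so commuting is an
  equivalence relation on noncentral elements, with classes \<open>C(x) - Z(G)\<close>. Each of these is a
  disjoint union of conjugacy classes of size \<open>p\<close>, because \<open>G/Z(G)\<close> is abelian; so \<open>p\<close> divides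
  \<open>pz - z\<close>, hence \<open>z\<close>, and the exceptional cases of the theorem do not occur. Moreover the graph
  is a disjoint union of cliques of equal size \<open>m = (p - 1)z/p\<close>. All row sums of \<open>CN\<close> are then
  equal to \<open>r = (m - 1)(m - 2)\<close>, which is also their mean, and \<open>CNL - r I = - CN\<close> and
  \<open>CNSL - r I = CN\<close>.\<close>

section \<open>Common neighbourhood energies when all row sums agree\<close>

lemma proots_prod_list_linear: "proots (\<Prod>a \<leftarrow> as. [:- a, 1:]) = mset (as :: 'a :: idom list)"
proof (induction as)
  case (Cons a as)
  have "(\<Prod>a \<leftarrow> as. [:- a, 1:]) \<noteq> 0"
    by (auto simp: prod_list_zero_iff)
  then show ?case
    using Cons proots_mult[of "[:- a, 1:]"] by (simp del: mult_pCons_left)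
qed simp

text \<open>By Schur decomposition \<open>A\<close> is similar to a triangular matrix
  \<open>B\<close>, and the same \<open>P\<close> and \<open>Q\<close> relate the shifted matrices.
  The diagonals then give all eigenvalues with multiplicity.\<close>

lemma proots_char_poly_shift:
  fixes A :: "complex mat"
  assumes A: "A \<in> carrier_mat n n"
  shows "proots (char_poly (r \<cdot>\<^sub>m 1\<^sub>m n + c \<cdot>\<^sub>m A)) =
    image_mset (\<lambda>a. r + c * a) (proots (char_poly A))"
proof -
  \<comment> \<open>Every complex polynomial splits, which is what Schur decomposition
    needs.\<close>
  obtain as where as: "char_poly A = (\<Prod>a \<leftarrow> as. [:- a, 1:])"
    using char_poly_factorized[OF A] by blast
  then obtain B where B: "B \<in> carrier_mat n n" "upper_triangular B" "similar_mat A B"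
    using schur_decomposition_exists[OF A] by blast
  then obtain P Q where "similar_mat_wit A B P Q"
    unfolding similar_mat_def by blast
  note PQ = similar_mat_witD2[OF A this]
  define shift :: "complex mat \<Rightarrow> complex mat" where "shift M = r \<cdot>\<^sub>m 1\<^sub>m n + c \<cdot>\<^sub>m M" for M
  have "P * shift B * Q = (P * (r \<cdot>\<^sub>m 1\<^sub>m n) + P * (c \<cdot>\<^sub>m B)) * Q"
    unfolding shift_def by (subst mult_add_distrib_mat[of _ n n]) (use PQ B in auto)
  also have "\<dots> = (r \<cdot>\<^sub>m P + c \<cdot>\<^sub>m (P * B)) * Q"
    using PQ B by (simp add: mult_smult_distrib[of _ n n _ n])
  also have "\<dots> = r \<cdot>\<^sub>m P * Q + c \<cdot>\<^sub>m (P * B) * Q"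
    by (rule add_mult_distrib_mat[of _ n n]) (use PQ B in auto)
  also have "\<dots> = r \<cdot>\<^sub>m (P * Q) + c \<cdot>\<^sub>m (P * B * Q)"
    using PQ B by (simp add: mult_smult_assoc_mat[of _ n n _ n])
  also have "\<dots> = shift A"
    using PQ by (simp add: shift_def)
  finally have "shift A = P * shift B * Q" ..
  then have "similar_mat (shift A) (shift B)"
    using PQ A B by (intro similar_matI[of _ _ P Q n]) (auto simp: shift_def)
  then have "char_poly (shift A) = char_poly (shift B)"
    by (rule char_poly_similar)
  also have "\<dots> = (\<Prod>a \<leftarrow> diag_mat (shift B). [:- a, 1:])"
    by (rule char_poly_upper_triangular[of _ n])
      (use B in \<open>auto simp: shift_def upper_triangular_def\<close>)
  also have "diag_mat (shift B) = map (\<lambda>a. r + c * a) (diag_mat B)"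
    using B by (auto simp: diag_mat_def shift_def)
  finally have "proots (char_poly (shift A)) = image_mset (\<lambda>a. r + c * a) (mset (diag_mat B))"
    by (simp only: proots_prod_list_linear mset_map)
  moreover have "char_poly A = (\<Prod>a \<leftarrow> diag_mat B. [:- a, 1:])"
    using char_poly_similar[OF B(3)] char_poly_upper_triangular[OF B(1,2)] by simp
  ultimately show ?thesis
    by (simp only: proots_prod_list_linear shift_def)
qed

lemma eigenvalues_mset_shift:
  assumes A: "A \<in> carrier_mat n n"
  shows "eigenvalues_mset (r \<cdot>\<^sub>m 1\<^sub>m n + c \<cdot>\<^sub>m A) =
    image_mset (\<lambda>a. complex_of_real r + complex_of_real c * a) (eigenvalues_mset A)"
proof -
  have "map_mat complex_of_real (r \<cdot>\<^sub>m 1\<^sub>m n + c \<cdot>\<^sub>m A) =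
      complex_of_real r \<cdot>\<^sub>m 1\<^sub>m n + complex_of_real c \<cdot>\<^sub>m map_mat complex_of_real A"
    using A by (intro eq_matI) auto
  then show ?thesis
    using proots_char_poly_shift[of "map_mat complex_of_real A" n] A
    by (simp add: eigenvalues_mset_def)
qed

text \<open>Here \<open>CNRS\<close> is the scalar matrix \<open>r I\<close> with mean
  \<open>r\<close>. After subtracting the mean, an eigenvalue \<open>a\<close> of \<open>CN\<close>
  contributes \<open>- a\<close> to one energy and \<open>a\<close> to the other, and both have the
  same modulus.\<close>

lemma energies_eq_if_CN_row_sums_eq:
  fixes \<Gamma> :: "'v pair_pre_digraph"
  defines "vs \<equiv> vertex_list \<Gamma>"
  assumes ne: "vs \<noteq> []"
    and row: "\<And>i. i < length vs \<Longrightarrow> (\<Sum>j < length vs. CN \<Gamma> vs $$ (i, j)) = r"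
  shows "LE_CN \<Gamma> = E_CN \<Gamma>" "LE_plus_CN \<Gamma> = E_CN \<Gamma>"
proof -
  let ?n = "length vs"
  have C: "CN \<Gamma> vs \<in> carrier_mat ?n ?n"
    by (simp add: CN_def)
  have R: "CNRS \<Gamma> vs = r \<cdot>\<^sub>m 1\<^sub>m ?n"
    by (rule eq_matI) (auto simp: CNRS_def mat_diag_def row)
  have "diag_mat (CNRS \<Gamma> vs) = replicate ?n r"
    by (rule nth_equalityI) (simp_all add: R diag_mat_def)
  \<comment> \<open>Nonemptiness enters here, as \<open>CN_mean\<close> divides by the number of
    vertices.\<close>
  then have mean: "CN_mean \<Gamma> vs = r"
    using ne by (simp add: CN_mean_def sum_list_replicate)
  have "CNL \<Gamma> vs = r \<cdot>\<^sub>m 1\<^sub>m ?n + (- 1) \<cdot>\<^sub>m CN \<Gamma> vs"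
    using C by (intro eq_matI) (auto simp: CNL_def R)
  then have "eigenvalues_mset (CNL \<Gamma> vs) =
      image_mset (\<lambda>a. complex_of_real r - a) (eigenvalues_mset (CN \<Gamma> vs))"
    by (simp add: eigenvalues_mset_shift[OF C])
  then show "LE_CN \<Gamma> = E_CN \<Gamma>"
    by (simp add: LE_CN_def E_CN_def mean flip: vs_def) (simp add: multiset.map_comp comp_def)
  have "CNSL \<Gamma> vs = r \<cdot>\<^sub>m 1\<^sub>m ?n + 1 \<cdot>\<^sub>m CN \<Gamma> vs"
    using C by (intro eq_matI) (auto simp: CNSL_def R)
  then have "eigenvalues_mset (CNSL \<Gamma> vs) =
      image_mset (\<lambda>a. complex_of_real r + a) (eigenvalues_mset (CN \<Gamma> vs))"
    by (simp add: eigenvalues_mset_shift[OF C])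
  then show "LE_plus_CN \<Gamma> = E_CN \<Gamma>"
    by (simp add: LE_plus_CN_def E_CN_def mean flip: vs_def) (simp add: multiset.map_comp comp_def)
qed

text \<open>The function \<open>f\<close> names the clique of a vertex. Each of the
  \<open>m - 1\<close> other members of a clique shares the remaining \<open>m - 2\<close> members
  with \<open>u\<close>; vertices outside share none. Truncated subtraction is harmless, since
  \<open>m \<ge> 1\<close> and the product is \<open>0\<close> for \<open>m = 1\<close>.\<close>

lemma CN_row_sum_disjoint_cliques:
  assumes fin: "finite (pverts \<Gamma>)"
    and arcs: "parcs \<Gamma> = {(u, v). u \<in> pverts \<Gamma> \<and> v \<in> pverts \<Gamma> \<and> u \<noteq> v \<and> f u = f v}"
    and size: "\<And>u. u \<in> pverts \<Gamma> \<Longrightarrow> card {v \<in> pverts \<Gamma>. f v = f u} = m"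
    and vs: "distinct vs" "set vs = pverts \<Gamma>"
    and i: "i < length vs"
  shows "(\<Sum>j < length vs. CN \<Gamma> vs $$ (i, j)) = real ((m - 1) * (m - 2))"
proof -
  define u where "u = vs ! i"
  define K where "K = {v \<in> pverts \<Gamma>. f v = f u}"
  have u: "u \<in> pverts \<Gamma>"
    using i vs nth_mem by (auto simp: u_def)
  have K: "finite K" "card K = m" "u \<in> K"
    using fin size u by (auto simp: K_def)
  \<comment> \<open>The row of \<open>u\<close> as a function of the other vertex; removing
    \<open>u\<close> accounts for the zero diagonal.\<close>
  define c where "c v = (if v \<in> K - {u} then real (m - 2) else 0)" for v
  have "CN \<Gamma> vs $$ (i, j) = c (vs ! j)" if j: "j < length vs" for j
  proof (cases "i = j")
    case True
    then show ?thesis using i by (simp add: CN_def c_def u_def)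
  next
    case False
    define v where "v = vs ! j"
    have v: "v \<in> pverts \<Gamma>" "v \<noteq> u"
      using False i j vs nth_mem by (auto simp: u_def v_def nth_eq_iff_index_eq)
    \<comment> \<open>A common neighbour has the label of both \<open>u\<close> and
      \<open>v\<close>, so there is none unless these labels agree.\<close>
    have "{w \<in> pverts \<Gamma>. w \<noteq> u \<and> w \<noteq> v \<and> (w, u) \<in> parcs \<Gamma> \<and> (w, v) \<in> parcs \<Gamma>} =
        (if v \<in> K then K - {u, v} else {})"
      using u v by (auto simp: arcs K_def)
    moreover have "card (K - {u, v}) = m - 2" if "v \<in> K"
      using that v K by (simp add: card_Diff_subset)
    ultimately show ?thesis
      using False i j v by (auto simp: CN_def c_def simp flip: u_def v_def)
  qed
  then have "(\<Sum>j < length vs. CN \<Gamma> vs $$ (i, j)) = (\<Sum>j < length vs. c (vs ! j))"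
    by simp
  also have "\<dots> = (\<Sum>v \<in> pverts \<Gamma>. c v)"
    using sum_nth_distinct[OF vs(1), of c] vs(2) by simp
  also have "\<dots> = (\<Sum>v \<in> K - {u}. real (m - 2))"
    by (rule sum.mono_neutral_cong_right) (use fin in \<open>auto simp: c_def K_def\<close>)
  also have "\<dots> = real ((m - 1) * (m - 2))"
    using K by simp
  finally show ?thesis .
qed

section \<open>Groups whose central quotient has order \<open>p\<^sup>2\<close>\<close>

definition centralizer :: "('a, 'b) monoid_scheme \<Rightarrow> 'a \<Rightarrow> 'a set" where
  "centralizer G x = {g \<in> carrier G. g \<otimes>\<^bsub>G\<^esub> x = x \<otimes>\<^bsub>G\<^esub> g}"

section \<open>Conjugacy classes, centralizers and the center of a group\<close>

context group
begin

lemma commute_iff_conj_eq: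
  assumes "g \<in> carrier G" "x \<in> carrier G"
  shows "g \<otimes> x = x \<otimes> g \<longleftrightarrow> g \<otimes> x \<otimes> inv g = x"
  using assms by (metis inv_closed inv_solve_right m_closed)

text \<open>Makes the stabilizer and orbit-stabilizer theorems for the conjugation action available
  for centralizers.\<close>

lemma centralizer_eq_stabilizer:
  assumes "x \<in> carrier G"
  shows "centralizer G x = stabilizer G (\<lambda>g. \<lambda>h \<in> carrier G. g \<otimes> h \<otimes> inv g) x"
  using assms by (auto simp: centralizer_def stabilizer_def commute_iff_conj_eq)

lemma subgroup_centralizer: "x \<in> carrier G \<Longrightarrow> subgroup (centralizer G x) G"
  using group_action.stabilizer_subgroup[OF action_by_conjugation]
  by (simp add: centralizer_eq_stabilizer)

lemma card_conj_class:
  "x \<in> carrier G \<Longrightarrow> card (conj_class G x) * card (centralizer G x) = Coset.order G"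
  using group_action.orbit_stabilizer_theorem[OF action_by_conjugation]
  by (simp add: centralizer_eq_stabilizer conj_class_def)

lemma conj_class_eq:
  "x \<in> carrier G \<Longrightarrow> conj_class G x = (\<lambda>g. g \<otimes> x \<otimes> inv g) ` carrier G"
  by (auto simp: conj_class_def orbit_def)

lemma conj_class_subset: "x \<in> carrier G \<Longrightarrow> conj_class G x \<subseteq> carrier G"
  by (auto simp: conj_class_eq)

lemma conj_class_refl: "x \<in> carrier G \<Longrightarrow> x \<in> conj_class G x"
  unfolding conj_class_def by (rule group_action.orbit_refl[OF action_by_conjugation])

text \<open>Distinct orbits are disjoint, and both classes contain \<open>y\<close>.\<close>

lemma conj_class_cong:
  assumes x: "x \<in> carrier G" and y: "y \<in> conj_class G x"
  shows "conj_class G y = conj_class G x"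
proof -
  have "y \<in> carrier G"
    using assms conj_class_subset by blast
  then have "conj_class G y \<in> orbits G (carrier G) (\<lambda>g. \<lambda>h \<in> carrier G. g \<otimes> h \<otimes> inv g)"
    "conj_class G x \<in> orbits G (carrier G) (\<lambda>g. \<lambda>h \<in> carrier G. g \<otimes> h \<otimes> inv g)"
    using x by (auto simp: orbits_def conj_class_def)
  from group_action.disjoint_union[OF action_by_conjugation this]
  show ?thesis
    using conj_class_refl \<open>y \<in> carrier G\<close> y by blast
qed

lemma center_eq_Int_centralizer: "center G = carrier G \<inter> (\<Inter>x \<in> carrier G. centralizer G x)"
  by (auto simp: center_def centralizer_def)

text \<open>With \<open>H = K\<close> this set is the center of \<open>K\<close>. It serves both for
  \<open>K = carrier G\<close> and for \<open>K\<close> a centralizer.\<close>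

lemma subgroup_carrier_Int_centralizers:
  assumes "H \<subseteq> carrier G" "subgroup K G"
  shows "subgroup (K \<inter> (\<Inter>x \<in> H. centralizer G x)) G"
proof -
  have "subgroup (\<Inter> (insert K (centralizer G ` H))) G"
    by (rule subgroups_Inter) (use assms subgroup_centralizer in auto)
  then show ?thesis by simp
qed

lemma normal_center: "center G \<lhd> G"
proof -
  have "subgroup (center G) G"
    unfolding center_eq_Int_centralizer
    by (rule subgroup_carrier_Int_centralizers) (auto intro: subgroup_self)
  moreover have "x \<otimes> h \<otimes> inv x = h" if "x \<in> carrier G" "h \<in> center G" for x h
    using that commute_iff_conj_eq[of x h] by (simp add: center_def)
  ultimately show ?thesis
    by (simp add: normal_inv_iff)
qed

lemma card_subgroup_dvd:
  assumes "subgroup H G" "subgroup K G" "H \<subseteq> K"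
  shows "card H dvd card K"
proof -
  interpret K: group "G\<lparr>carrier := K\<rparr>"
    using assms(2) is_group by (rule subgroup.subgroup_is_group)
  have "subgroup H (G\<lparr>carrier := K\<rparr>)"
    using assms by (rule subgroup_incl)
  from K.lagrange[OF this] have "card K = card (rcosets\<^bsub>G\<lparr>carrier := K\<rparr>\<^esub> H) * card H"
    by (simp add: Coset.order_def)
  then show ?thesis
    by (rule dvdI[OF trans[OF _ mult.commute]])
qed

text \<open>In the commutative quotient \<open>g \<otimes> x\<close> and
  \<open>x \<otimes> g\<close> have the same coset, so they differ by a central factor
  \<open>c\<close>.\<close>

lemma conj_in_center_coset:
  assumes comm: "comm_group (G Mod center G)" and x: "x \<in> carrier G" and g: "g \<in> carrier G"
  shows "\<exists>c \<in> center G. g \<otimes> x \<otimes> inv g = c \<otimes> x"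
proof -
  interpret Z: normal "center G" G by (rule normal_center)
  interpret Q: comm_group "G Mod center G" by (rule comm)
  have "center G #> (g \<otimes> x) = center G #> (x \<otimes> g)"
    using Q.m_comm[of "center G #> g" "center G #> x"] x g
    by (simp add: carrier_FactGroup Z.rcos_sum)
  moreover have "g \<otimes> x \<in> center G #> (g \<otimes> x)"
    using x g by (intro rcos_self Z.subgroup_axioms) auto
  ultimately obtain c where c: "c \<in> center G" "g \<otimes> x = c \<otimes> (x \<otimes> g)"
    by (auto simp: r_coset_def)
  then have "g \<otimes> x \<otimes> inv g = c \<otimes> x"
    using x g Z.subset by (simp add: inv_solve_right' m_assoc subset_iff)
  with c show ?thesis by blast
qed

end

text \<open>Keeps the two consequences of the isomorphism that drive the argument: the index of the
  center and the commutativity of the quotient.\<close>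

locale center_index_prime_square = group G for G (structure) +
  fixes p :: nat
  assumes fin: "finite (carrier G)"
    and prime_p: "prime p"
    and order_eq: "Coset.order G = p\<^sup>2 * card (center G)"
    and comm_quot: "comm_group (G Mod center G)"
begin

section \<open>Centralizers and conjugacy classes of noncentral elements\<close>

abbreviation "noncentral \<equiv> carrier G - center G"

lemma subgroup_center: "subgroup (center G) G"
  using normal_center by (rule normal_imp_subgroup)

lemma center_subset: "center G \<subseteq> carrier G"
  by (auto simp: center_def)

lemma finite_center: "finite (center G)"
  using center_subset fin by (rule finite_subset)

lemma card_center_pos: "card (center G) > 0"
  using subgroup.one_closed[OF subgroup_center] finite_center by (auto simp: card_gt_0_iff)

lemma centralizer_subset: "centralizer G x \<subseteq> carrier G"
  by (auto simp: centralizer_def)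

lemma finite_centralizer: "finite (centralizer G x)"
  using centralizer_subset fin by (rule finite_subset)

lemma center_subset_centralizer: "x \<in> carrier G \<Longrightarrow> center G \<subseteq> centralizer G x"
  by (auto simp: center_def centralizer_def)

lemma self_in_centralizer: "x \<in> carrier G \<Longrightarrow> x \<in> centralizer G x"
  by (auto simp: centralizer_def)

text \<open>The centralizer lies strictly between the center and \<open>G\<close>: it contains the
  noncentral \<open>x\<close>, and it is not everything. Its index over the center divides
  \<open>p\<close> squared, hence is \<open>p\<close>.\<close>

lemma card_centralizer:
  assumes x: "x \<in> noncentral"
  shows "card (centralizer G x) = p * card (center G)"
proof -
  let ?z = "card (center G)" and ?C = "centralizer G x"
  obtain k where k: "card ?C = ?z * k"
    using card_subgroup_dvd[OF subgroup_center subgroup_centralizer[of x]]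
      center_subset_centralizer[of x] x by (auto simp: dvd_def)
  have "card ?C dvd p\<^sup>2 * ?z"
    using card_subgroup_dvd[OF subgroup_centralizer[of x] subgroup_self] centralizer_subset x
    by (simp add: Coset.order_def flip: order_eq)
  then have "k dvd p\<^sup>2"
    using k card_center_pos by (simp add: mult.commute[of ?z])
  then obtain e where e: "k = p ^ e" "e \<le> 2"
    using prime_p by (auto simp: divides_primepow_nat)
  have "e \<noteq> 0"
  proof
    assume "e = 0"
    then have "center G = ?C"
      using x e k by (intro card_subset_eq finite_centralizer center_subset_centralizer) auto
    then show False
      using x self_in_centralizer by auto
  qed
  moreover have "e \<noteq> 2"
  proof
    assume "e = 2"
    then have "?C = carrier G"
      using e k order_eq
      by (intro card_subset_eq fin centralizer_subset) (simp add: Coset.order_def mult.commute)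
    then have "\<forall>g \<in> carrier G. g \<in> centralizer G x"
      by simp
    then have "x \<in> center G"
      using x by (simp add: center_def centralizer_def)
    then show False
      using x by simp
  qed
  ultimately have "e = 1"
    using e by linarith
  then show ?thesis
    using k e by (simp add: mult.commute)
qed

text \<open>The centralizer of \<open>x\<close> is abelian: its own center contains
  \<open>center G\<close> and also \<open>x\<close>, and there is no room between index
  \<open>1\<close> and the prime index \<open>p\<close>. So it lies in the centralizer of
  \<open>y\<close>, which has the same order.\<close>

lemma centralizer_eq_if_commute:
  assumes x: "x \<in> noncentral" and y: "y \<in> noncentral" "y \<in> centralizer G x"
  shows "centralizer G y = centralizer G x"
proof -
  let ?C = "centralizer G x" and ?z = "card (center G)"
  \<comment> \<open>The center of \<open>?C\<close>.\<close>
  define D where "D = ?C \<inter> (\<Inter>c \<in> ?C. centralizer G c)"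
  have D: "subgroup D G"
    unfolding D_def
    by (rule subgroup_carrier_Int_centralizers)
      (use x in \<open>auto intro: subgroup_centralizer simp: centralizer_subset\<close>)
  have zD: "center G \<subseteq> D"
    using x by (auto simp: D_def center_def centralizer_def)
  have xD: "x \<in> D"
    using x by (auto simp: D_def centralizer_def)
  obtain k where k: "card D = ?z * k"
    using card_subgroup_dvd[OF subgroup_center D zD] by (auto simp: dvd_def)
  have DC: "D \<subseteq> ?C" by (simp add: D_def)
  have "card D dvd p * ?z"
    using card_subgroup_dvd[OF D subgroup_centralizer[of x] DC] x card_centralizer[OF x] by simp
  then have "k dvd p"
    using k card_center_pos by (simp add: mult.commute[of ?z])
  moreover have "k \<noteq> 1"
  proof
    assume "k = 1"
    then have "center G = D"
      using k zD DC finite_subset[OF DC finite_centralizer] by (intro card_subset_eq) auto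
    then show False
      using x xD by simp
  qed
  ultimately have "k = p"
    using prime_p by (auto simp: prime_nat_iff)
  then have "D = ?C"
    using k DC card_centralizer[OF x] by (intro card_subset_eq finite_centralizer) auto
  then have "?C \<subseteq> centralizer G y"
    using y(2) by (auto simp: D_def centralizer_def)
  then have "?C = centralizer G y"
    using card_centralizer[OF x] card_centralizer[OF y(1)]
    by (intro card_subset_eq finite_centralizer) auto
  then show ?thesis ..
qed

text \<open>Orbit-stabilizer with the known order of the centralizer.\<close>

lemma card_conj_class_noncentral:
  assumes x: "x \<in> noncentral"
  shows "card (conj_class G x) = p"
proof -
  have "card (conj_class G x) * (p * card (center G)) = p * (p * card (center G))"
    using card_conj_class[of x] x
    by (auto simp: card_centralizer[OF x] order_eq power2_eq_square)
  then show ?thesis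
    using card_center_pos prime_gt_0_nat[OF prime_p] by simp
qed

text \<open>A conjugate of \<open>x\<close> is \<open>c \<otimes> x\<close> with \<open>c\<close>
  central. It commutes with \<open>x\<close>, and were it central, cancelling \<open>c\<close> would
  make \<open>x\<close> central.\<close>

lemma conj_class_noncentral:
  assumes x: "x \<in> noncentral"
  shows "conj_class G x \<subseteq> centralizer G x - center G"
proof
  fix y assume y: "y \<in> conj_class G x"
  then obtain c where c: "c \<in> center G" "y = c \<otimes> x"
    using conj_in_center_coset[OF comm_quot] x by (auto simp: conj_class_eq)
  interpret C: subgroup "centralizer G x" G
    using x by (intro subgroup_centralizer) auto
  have "y \<in> centralizer G x"
    using c x center_subset_centralizer self_in_centralizer by auto
  moreover have "y \<notin> center G"
  proof
    assume "y \<in> center G"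
    then have "inv c \<otimes> y \<in> center G"
      using c subgroup_center by (simp add: subgroup.m_closed subgroup.m_inv_closed)
    moreover have "inv c \<otimes> y = x"
      using c x center_subset inv_solve_left'[of x c y] by auto
    ultimately show False
      using x by simp
  qed
  ultimately show "y \<in> centralizer G x - center G" by simp
qed

lemma centralizer_cong_conj_class:
  assumes x: "x \<in> noncentral" and y: "y \<in> conj_class G x"
  shows "y \<in> noncentral" "centralizer G y = centralizer G x"
proof -
  have "y \<in> centralizer G x - center G"
    using conj_class_noncentral[OF x] y by blast
  then show *: "y \<in> noncentral"
    using centralizer_subset by blast
  then show "centralizer G y = centralizer G x"
    using centralizer_eq_if_commute[OF x] \<open>y \<in> centralizer G x - center G\<close> by blast
qed

text \<open>All members of a noncentral class have the same centralizer, and two classes are adjacent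
  iff these centralizers agree.\<close>

definition clique_label :: "'a set \<Rightarrow> 'a set" where
  "clique_label X = (\<Union>x \<in> X. centralizer G x)"

text \<open>The union runs over equal sets, which avoids choosing a representative.\<close>

lemma clique_label_conj_class:
  assumes "x \<in> noncentral"
  shows "clique_label (conj_class G x) = centralizer G x"
  using centralizer_cong_conj_class(2)[OF assms] conj_class_refl[of x] assms
  unfolding clique_label_def by blast

section \<open>Cliques of the commuting conjugacy class graph\<close>

lemma pverts_ccc_graph: "pverts (ccc_graph G) = conj_class G ` noncentral"
  by (simp add: ccc_graph_def Let_def)

text \<open>Commuting representatives have equal centralizers, and these are shared by their whole
  classes. Conversely, equal labels make \<open>x\<close> itself commute with
  \<open>y\<close>.\<close>

lemma parcs_ccc_graph:
  "parcs (ccc_graph G) = {(X, Y). X \<in> pverts (ccc_graph G) \<and> Y \<in> pverts (ccc_graph G) \<and>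
     X \<noteq> Y \<and> clique_label X = clique_label Y}"
proof -
  have "(\<exists>x' \<in> conj_class G x. \<exists>y' \<in> conj_class G y. x' \<otimes> y' = y' \<otimes> x') \<longleftrightarrow>
      clique_label (conj_class G x) = clique_label (conj_class G y)"
    if x: "x \<in> noncentral" and y: "y \<in> noncentral" for x y
  proof
    assume "\<exists>x' \<in> conj_class G x. \<exists>y' \<in> conj_class G y. x' \<otimes> y' = y' \<otimes> x'"
    then obtain x' y' where xy': "x' \<in> conj_class G x" "y' \<in> conj_class G y"
      and comm: "x' \<otimes> y' = y' \<otimes> x'" by blast
    note x' = centralizer_cong_conj_class[OF x xy'(1)]
    note y' = centralizer_cong_conj_class[OF y xy'(2)]
    have "x' \<in> centralizer G y'"
      using comm x'(1) by (simp add: centralizer_def)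
    then have "centralizer G x' = centralizer G y'"
      using centralizer_eq_if_commute x'(1) y'(1) by blast
    then show "clique_label (conj_class G x) = clique_label (conj_class G y)"
      using x y x' y' by (simp add: clique_label_conj_class)
  next
    assume "clique_label (conj_class G x) = clique_label (conj_class G y)"
    then have "x \<in> centralizer G y"
      using x y self_in_centralizer[of x] by (simp add: clique_label_conj_class)
    then show "\<exists>x' \<in> conj_class G x. \<exists>y' \<in> conj_class G y. x' \<otimes> y' = y' \<otimes> x'"
      using x y conj_class_refl by (auto simp: centralizer_def)
  qed
  then show ?thesis
    by (auto simp: ccc_graph_def Let_def)
qed

text \<open>Both sides count the noncentral elements of the centralizer, the left one by classes of
  size \<open>p\<close>. The undivided form yields that \<open>p\<close> divides the order of the
  center.\<close>

lemma clique_size: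
  assumes x: "x \<in> noncentral"
  shows "p * card {Y \<in> pverts (ccc_graph G). clique_label Y = centralizer G x} =
    (p - 1) * card (center G)"
proof -
  let ?K = "{Y \<in> pverts (ccc_graph G). clique_label Y = centralizer G x}"
  \<comment> \<open>For noncentral \<open>y\<close>, having the centralizer of \<open>x\<close> is
    the same as lying in it.\<close>
  have K: "?K = conj_class G ` (centralizer G x - center G)"
  proof -
    have "centralizer G y = centralizer G x \<longleftrightarrow> y \<in> centralizer G x" if "y \<in> noncentral" for y
      using that centralizer_eq_if_commute[OF x that] self_in_centralizer[of y] by auto
    then have "clique_label (conj_class G y) = centralizer G x \<longleftrightarrow> y \<in> centralizer G x"
      if "y \<in> noncentral" for y
      using that by (simp add: clique_label_conj_class)
    moreover have "centralizer G x - center G = {y \<in> noncentral. y \<in> centralizer G x}"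
      using centralizer_subset by blast
    ultimately show ?thesis
      by (auto simp: pverts_ccc_graph)
  qed
  have U: "\<Union>?K = centralizer G x - center G"
  proof
    show "\<Union>?K \<subseteq> centralizer G x - center G"
    proof
      fix y assume "y \<in> \<Union>?K"
      then obtain u where u: "u \<in> noncentral" "centralizer G u = centralizer G x"
        "y \<in> conj_class G u"
        by (auto simp: pverts_ccc_graph clique_label_conj_class)
      then show "y \<in> centralizer G x - center G"
        using conj_class_noncentral[of u] by auto
    qed
    show "centralizer G x - center G \<subseteq> \<Union>?K"
      unfolding K using conj_class_refl centralizer_subset by blast
  qed
  have "p * card ?K = card (\<Union>?K)"
  proof (rule card_partition)
    show "finite ?K"
      unfolding K by (simp add: finite_centralizer)
    show "finite (\<Union>?K)"
      unfolding U by (simp add: finite_centralizer)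
    show "card c = p" if "c \<in> ?K" for c
      using that card_conj_class_noncentral by (auto simp: pverts_ccc_graph)
    show "c1 \<inter> c2 = {}" if c: "c1 \<in> ?K" "c2 \<in> ?K" "c1 \<noteq> c2" for c1 c2
    proof (rule ccontr)
      assume "c1 \<inter> c2 \<noteq> {}"
      then obtain u where "u \<in> c1" "u \<in> c2" by blast
      then have "c1 = conj_class G u" "c2 = conj_class G u"
        using c(1,2) conj_class_cong by (auto simp: pverts_ccc_graph)
      with c(3) show False by simp
    qed
  qed
  also have "\<dots> = (p - 1) * card (center G)"
    using x unfolding U
    by (simp add: card_Diff_subset finite_center center_subset_centralizer card_centralizer
        diff_mult_distrib)
  finally show ?thesis .
qed

section \<open>Divisibility of the order of the center, and equality of the energies\<close>

lemma noncentral_nonempty: "noncentral \<noteq> {}"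
proof
  assume "noncentral = {}"
  then have "center G = carrier G"
    using center_subset by blast
  then have "p\<^sup>2 = 1"
    using order_eq card_center_pos by (simp add: Coset.order_def)
  then show False
    using prime_gt_1_nat[OF prime_p] by simp
qed

text \<open>The clique equation makes \<open>p\<close> divide
  \<open>(p - 1) * card (center G)\<close>, and the prime \<open>p\<close> cannot divide the smaller
  positive number \<open>p - 1\<close>.\<close>

lemma prime_dvd_card_center: "p dvd card (center G)"
proof -
  obtain x where "x \<in> noncentral"
    using noncentral_nonempty by blast
  from clique_size[OF this] have "p dvd (p - 1) * card (center G)"
    by (metis dvd_triv_left)
  moreover have "\<not> p dvd p - 1"
    using prime_gt_1_nat[OF prime_p] by (auto dest: dvd_imp_le)
  ultimately show ?thesis
    using prime_p by (simp add: prime_dvd_mult_iff)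
qed

lemma energies_ccc_graph_eq:
  "LE_CN (ccc_graph G) = E_CN (ccc_graph G)" "LE_plus_CN (ccc_graph G) = E_CN (ccc_graph G)"
proof -
  let ?vs = "vertex_list (ccc_graph G)"
  \<comment> \<open>The common clique size; the division is exact by
    \<open>clique_size\<close>.\<close>
  define m where "m = (p - 1) * card (center G) div p"
  have fin_verts: "finite (pverts (ccc_graph G))"
    using fin by (simp add: pverts_ccc_graph)
  note vs = distinct_vertex_list[OF fin_verts]
  have ne: "?vs \<noteq> []"
    using vs(2) noncentral_nonempty by (auto simp: pverts_ccc_graph)
  have "card {Y \<in> pverts (ccc_graph G). clique_label Y = clique_label X} = m"
    if X: "X \<in> pverts (ccc_graph G)" for X
  proof -
    obtain x where x: "x \<in> noncentral" "X = conj_class G x"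
      using X by (auto simp: pverts_ccc_graph)
    have "m = p * card {Y \<in> pverts (ccc_graph G). clique_label Y = centralizer G x} div p"
      by (simp only: m_def clique_size[OF x(1)])
    then show ?thesis
      using x prime_gt_0_nat[OF prime_p] by (simp add: clique_label_conj_class)
  qed
  note row = CN_row_sum_disjoint_cliques[OF fin_verts parcs_ccc_graph this vs]
  show "LE_CN (ccc_graph G) = E_CN (ccc_graph G)" "LE_plus_CN (ccc_graph G) = E_CN (ccc_graph G)"
    using energies_eq_if_CN_row_sums_eq[OF ne row] by simp_all
qed

end

text \<open>The order comes from Lagrange and \<open>card (carrier ?P)\<close>; commutativity is
  carried back along the inverse isomorphism.\<close>

lemma center_index_prime_squareI:
  fixes G (structure)
  assumes "group G" "finite (carrier G)" "prime p"
    and iso: "G Mod center G \<cong> integer_mod_group p \<times>\<times> integer_mod_group p"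
  shows "center_index_prime_square G p"
proof -
  interpret group G by fact
  interpret Z: normal "center G" G by (rule normal_center)
  let ?P = "integer_mod_group p \<times>\<times> integer_mod_group p"
  have "group ?P"
    by (intro DirProd_group) simp_all
  then have P: "comm_group ?P"
    by (rule group.group_comm_groupI) (auto simp: add.commute)
  have Q: "group (G Mod center G)"
    by (rule Z.factorgroup_is_group)
  show ?thesis
  proof (intro center_index_prime_square.intro center_index_prime_square_axioms.intro)
    have "card (rcosets center G) = card (carrier ?P)"
      using iso_same_card[OF iso] by (simp add: FactGroup_def)
    also have "\<dots> = p\<^sup>2"
      using prime_gt_0_nat[OF \<open>prime p\<close>]
      by (simp add: carrier_integer_mod_group card_cartesian_product power2_eq_square)
    finally show "Coset.order G = p\<^sup>2 * card (center G)"
      using lagrange[OF Z.subgroup_axioms] by simp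
    show "comm_group (G Mod center G)"
      using comm_group.iso_imp_comm_group[OF P group.iso_sym[OF Q iso]] Q
      by (simp add: group.is_monoid)
  qed (fact assms)+
qed

theorem theorem3p8:
  fixes G :: "('a, 'b) monoid_scheme" and p z :: nat
  assumes "group G" and "finite (carrier G)"
    and "card (center G) = z" and "z \<ge> 2"
    and "prime p"
    and "G Mod center G \<cong> integer_mod_group p \<times>\<times> integer_mod_group p"
  shows "((p = 2 \<and> z = 3) \<or> (p \<ge> 3 \<and> z = 2) \<longrightarrow>
            E_CN (ccc_graph G) < LE_CN (ccc_graph G) \<and>
            LE_CN (ccc_graph G) = LE_plus_CN (ccc_graph G)) \<and>
         (\<not> ((p = 2 \<and> z = 3) \<or> (p \<ge> 3 \<and> z = 2)) \<longrightarrow>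
            E_CN (ccc_graph G) = LE_CN (ccc_graph G) \<and>
            LE_CN (ccc_graph G) = LE_plus_CN (ccc_graph G))"
proof -
  interpret center_index_prime_square G p
    using assms by (intro center_index_prime_squareI)
  \<comment> \<open>Since \<open>p\<close> divides \<open>z\<close>, neither \<open>p = 2\<close>
    with \<open>z = 3\<close> nor \<open>p \<ge> 3\<close> with \<open>z = 2\<close> can occur. The
    strict inequality is thus claimed vacuously.\<close>
  have "\<not> ((p = 2 \<and> z = 3) \<or> (p \<ge> 3 \<and> z = 2))"
    using prime_dvd_card_center assms(3) by (auto dest: dvd_imp_le)
  then show ?thesis
    using energies_ccc_graph_eq by simp
qed

end
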